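(* Let $J$ be a finite index set, let $g_j \colon \mathbb{R}^n \to \mathbb{R}$, $j \in J$, be convex differentiable functions, let $C = \{ x \in \mathbb{R}^n : g_j(x) \le 0,\ j \in J \}$, let $c \in \mathbb{R}^n$, and consider the mixed-integer convex program $\min\{ c^T x : x \in C \cap (\mathbb{Z}^p \times \mathbb{R}^{n-p}) \}$. Assume that $0$ lies in the interior of $C$ and that $\nabla g_j(x) \neq 0$ for all $j \in J$ and all $x \in \partial C$. Let $f(x) = \max_{j \in J} g_j(x)$, let $\bar{x} \in \mathbb{R}^n$ with $\bar{x} \notin C$ (the current relaxation solution to separate), let $\hat{x} = \frac{\bar{x}}{\varphi_C(\bar{x})}$, where $\varphi_C$ is the gauge function of $C$, and let $v \in \partial f(\hat{x})$. Then the inequality $$f(\hat{x}) + v^T (x - \hat{x}) \le 0,$$ generated by the extended supporting hyperplane algorithm with interior point $0$, can also be generated by Kelley's cutting plane algorithm applied to $\min\{ c^T x : \varphi_C(x) \le 1\}$ when separating $\bar{x}$; that is, there exists a subgradient $w \in \partial \varphi_C(\bar{x})$ such that the inequality $$\varphi_C(\bar{x}) + w^T(x - \bar{x}) \le 1$$ is the same linear inequality in $x$, up to multiplication by a positive scalar.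
   Context: The gauge function of a convex set $C \subseteq \mathbb{R}^n$ with $0$ in its interior is $\varphi_C(x) = \inf\{ t > 0 : x \in tC \}$. The subdifferential of a convex function $h \colon \mathbb{R}^n \to \mathbb{R}$ at $y$ is $\partial h(y) = \{ v \in \mathbb{R}^n : h(y) + v^T(x-y) \le h(x) \text{ for all } x \in \mathbb{R}^n\}$; for a set $C$, $\partial C$ denotes its topological boundary. Kelley's cutting plane algorithm, applied to a problem with convex constraint $h(x) \le 0$, separates an infeasible point $\bar{x}$ by a cut $h(\bar{x}) + w^T(x - \bar{x}) \le 0$ with an arbitrary $w \in \partial h(\bar{x})$; here $h = \varphi_C - 1$. The extended supporting hyperplane algorithm with interior point $0$ separates $\bar{x}\notin C$ by a cut $f(\hat{x}) + v^T(x-\hat{x}) \le 0$, $v \in \partial f(\hat{x})$, where $\hat{x}$ is the boundary point of $C$ on the segment between $0$ and $\bar{x}$, equivalently $\hat{x} = \bar{x}/\varphi_C(\bar{x})$. *)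

theory Defs
  imports "HOL-Analysis.Analysis"
begin

definition gradient :: "('a::real_inner \<Rightarrow> real) \<Rightarrow> 'a \<Rightarrow> 'a"
  where "gradient f x = (THE D. GDERIV f x :> D)"

(* The name "gauge" is taken by the gauges of Henstock-Kurzweil integration. *)
definition gauge_function :: "'a::real_vector set \<Rightarrow> 'a \<Rightarrow> real"
  where "gauge_function C x = Inf {t. t > 0 \<and> x \<in> (\<lambda>y. t *\<^sub>R y) ` C}"

definition subdifferential :: "('a::real_inner \<Rightarrow> real) \<Rightarrow> 'a \<Rightarrow> 'a set"
  where "subdifferential h y = {v. \<forall>x. h y + v \<bullet> (x - y) \<le> h x}"

lemma GDERIV_imp_gradient:
  assumes "GDERIV f x :> D"
  shows "gradient f x = D"
  unfolding gradient_def
proof (rule the_equality)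
  fix E assume "GDERIV f x :> E"
  with assms have "(\<lambda>h. h \<bullet> E) = (\<lambda>h. h \<bullet> D)"
    unfolding gderiv_def by (intro has_derivative_unique)
  then have "\<forall>h. h \<bullet> E = h \<bullet> D"
    by (rule fun_cong[THEN allI])
  then show "E = D"
    using vector_eq_ldot by blast
qed (rule assms)

lemma differentiable_imp_GDERIV_gradient:
  fixes f :: "'a::euclidean_space \<Rightarrow> real"
  assumes "f differentiable (at x)"
  shows "GDERIV f x :> gradient f x"
proof -
  obtain f' where f': "(f has_derivative f') (at x)"
    using assms by (auto simp: differentiable_def)
  then have "linear f'"
    by (rule has_derivative_linear)
  then have "f' h = h \<bullet> adjoint f' 1" for h
    using adjoint_works[of f' h "1::real"] by simp
  then have "f' = (\<lambda>h. h \<bullet> adjoint f' 1)"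
    by blast
  with f' have "GDERIV f x :> adjoint f' 1"
    unfolding gderiv_def by simp
  then show ?thesis
    using GDERIV_imp_gradient by metis
qed

end

theory Submission
  imports Defs
begin

text \<open>
  A subgradient \<open>v\<close> of \<open>f\<close> at the boundary point \<open>xhat\<close>, where \<open>f\<close> vanishes, satisfies
  \<open>v \<bullet> y \<le> v \<bullet> xhat\<close> on \<open>C\<close>. If \<open>v \<noteq> 0\<close>, then \<open>v \<bullet> xhat > 0\<close> because \<open>0\<close> is interior, so
  \<open>w = v / (v \<bullet> xhat)\<close> is bounded by \<open>1\<close> on \<open>C\<close>, hence by the gauge everywhere, and it attains the
  gauge at \<open>xbar\<close>: it is a subgradient of the gauge there. If \<open>v\<close> were \<open>0\<close>, then \<open>f \<ge> 0\<close>, so some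
  \<open>g j\<close> vanishes at \<open>0\<close>; it is nonpositive near \<open>0\<close>, so by convexity \<open>0\<close> is a global minimum,
  and \<open>xhat\<close> is another one, contradicting the nonvanishing gradient at \<open>xhat\<close>.
\<close>

lemma gauge_function_eq:
  "gauge_function C x = Inf {t. t > 0 \<and> x /\<^sub>R t \<in> C}"
proof -
  have "x \<in> (\<lambda>y. t *\<^sub>R y) ` C \<longleftrightarrow> x /\<^sub>R t \<in> C" if "t > 0" for t
    using that by (force simp: image_iff)
  then show ?thesis
    unfolding gauge_function_def by (metis (no_types, lifting))
qed

lemma gauge_function_le:
  assumes "t > 0" "x /\<^sub>R t \<in> C"
  shows "gauge_function C x \<le> t"
  unfolding gauge_function_eq using assms
  by (intro cInf_lower bdd_belowI[of _ 0]) auto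

lemma interior_absorbing:
  fixes x :: "'a::real_normed_vector"
  assumes "0 \<in> interior C"
  obtains t where "t > 0" "x /\<^sub>R t \<in> C"
proof -
  obtain e where e: "e > 0" "ball 0 e \<subseteq> C"
    using assms by (auto simp: mem_interior)
  \<comment> \<open>The summand \<open>1\<close> keeps \<open>t\<close> positive at
    \<open>x = 0\<close> and makes \<open>norm x / t < e\<close> strict.\<close>
  define t where "t = (norm x + 1) / e"
  have "t > 0"
    using e by (simp add: t_def add_nonneg_pos)
  moreover have "norm x / t < e"
    using e \<open>t > 0\<close> by (simp add: t_def field_simps add_nonneg_pos)
  then have "x /\<^sub>R t \<in> C"
    using e \<open>t > 0\<close> by (auto simp: divide_inverse mult.commute intro!: subsetD[OF e(2)])
  ultimately show thesis
    by (rule that)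
qed

lemma gauge_function_ge:
  fixes x :: "'a::real_normed_vector"
  assumes "0 \<in> interior C"
    and "\<And>t. t > 0 \<Longrightarrow> x /\<^sub>R t \<in> C \<Longrightarrow> b \<le> t"
  shows "b \<le> gauge_function C x"
  unfolding gauge_function_eq
  using assms interior_absorbing[OF assms(1), of x] by (intro cInf_greatest) auto

text \<open>A bound by \<open>1\<close> on \<open>C\<close> scales to a bound by \<open>t\<close> on
  the dilate of \<open>C\<close> by \<open>t\<close>. This turns a linear inequality valid on
  \<open>C\<close> into the global subgradient inequality.\<close>

lemma inner_le_gauge_function:
  fixes w :: "'a::real_inner"
  assumes "0 \<in> interior C" "\<And>y. y \<in> C \<Longrightarrow> w \<bullet> y \<le> 1"
  shows "w \<bullet> x \<le> gauge_function C x"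
proof (rule gauge_function_ge[OF assms(1)])
  fix t :: real assume "t > 0" "x /\<^sub>R t \<in> C"
  then show "w \<bullet> x \<le> t"
    using assms(2)[of "x /\<^sub>R t"] by (simp add: field_simps)
qed

text \<open>If some \<open>t < 1\<close> were admissible, \<open>x\<close> would lie on the segment
  from \<open>0\<close> to \<open>x /\<^sub>R t\<close>, hence in \<open>C\<close>.\<close>

lemma gauge_function_ge_1:
  fixes x :: "'a::real_normed_vector"
  assumes "0 \<in> interior C" "convex C" "x \<notin> C"
  shows "gauge_function C x \<ge> 1"
proof (rule gauge_function_ge[OF assms(1)], rule ccontr)
  fix t :: real assume t: "t > 0" "x /\<^sub>R t \<in> C" "\<not> 1 \<le> t"
  have "0 \<in> C"
    using assms(1) interior_subset by auto
  then have "(1 - t) *\<^sub>R 0 + t *\<^sub>R (x /\<^sub>R t) \<in> C"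
    using t by (intro convexD[OF assms(2)]) auto
  then show False
    using t assms(3) by simp
qed

text \<open>The gauge is a limit of admissible scalings, which puts the point in the closure. Were
  it interior, a slightly smaller scaling would still be admissible, against the infimum.\<close>

lemma scaled_gauge_in_frontier:
  fixes x :: "'a::real_normed_vector"
  assumes "0 \<in> interior C" "gauge_function C x > 0"
  shows "x /\<^sub>R gauge_function C x \<in> frontier C"
proof -
  let ?p = "gauge_function C x"
  let ?S = "{t. t > 0 \<and> x /\<^sub>R t \<in> C}"
  have cont: "isCont (\<lambda>t. x /\<^sub>R t) ?p"
    using assms(2) by (intro continuous_intros) auto
  have "?p \<in> closure ?S"
    unfolding gauge_function_eq using interior_absorbing[OF assms(1), of x]
    by (intro closure_contains_Inf bdd_belowI[of _ 0]) auto
  then obtain s where s: "\<And>n. s n \<in> ?S" "s \<longlonglongrightarrow> ?p"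
    by (auto simp: closure_sequential)
  have "(\<lambda>n. x /\<^sub>R s n) \<longlonglongrightarrow> x /\<^sub>R ?p"
    using isCont_tendsto_compose[OF cont s(2)] .
  with s(1) have "x /\<^sub>R ?p \<in> closure C"
    unfolding closure_sequential by (intro exI[of _ "\<lambda>n. x /\<^sub>R s n"]) auto
  moreover have "x /\<^sub>R ?p \<notin> interior C"
  proof
    assume "x /\<^sub>R ?p \<in> interior C"
    with cont have "\<forall>\<^sub>F t in at ?p. x /\<^sub>R t \<in> interior C"
      unfolding isCont_def by (rule topological_tendstoD[OF _ open_interior])
    then obtain d where d: "d > 0" "\<And>t. t \<noteq> ?p \<Longrightarrow> dist t ?p < d \<Longrightarrow> x /\<^sub>R t \<in> interior C"
      unfolding eventually_at by auto
    \<comment> \<open>Half the minimum keeps \<open>t\<close> both positive and within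
      \<open>d\<close> of \<open>?p\<close>.\<close>
    define t where "t = ?p - min d ?p / 2"
    have t: "0 < t" "t < ?p" "dist t ?p < d"
      using d(1) assms(2) by (auto simp: t_def dist_real_def min_def)
    then have "x /\<^sub>R t \<in> C"
      using d(2)[of t] interior_subset[of C] by auto
    with gauge_function_le[of t x C] t show False
      by simp
  qed
  ultimately show ?thesis
    by (simp add: frontier_def)
qed

lemma convex_on_sublevel:
  fixes h :: "'a::real_vector \<Rightarrow> real"
  assumes "convex_on UNIV h"
  shows "convex {x. h x \<le> b}"
proof (rule convexI)
  fix x y :: 'a and u v :: real
  assume xy: "x \<in> {x. h x \<le> b}" "y \<in> {x. h x \<le> b}" and uv: "0 \<le> u" "0 \<le> v" "u + v = 1"
  have "h (u *\<^sub>R x + v *\<^sub>R y) \<le> u * h x + v * h y"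
    using assms uv by (simp add: convex_on_def)
  also have "\<dots> \<le> b"
    using xy uv by (intro convex_bound_le) auto
  finally show "u *\<^sub>R x + v *\<^sub>R y \<in> {x. h x \<le> b}"
    by simp
qed

lemma gradient_eq_0_at_local_extremum:
  fixes h :: "'a::euclidean_space \<Rightarrow> real"
  assumes "h differentiable (at x)" "e > 0"
    and "(\<forall>y\<in>ball x e. h y \<le> h x) \<or> (\<forall>y\<in>ball x e. h x \<le> h y)"
  shows "gradient h x = 0"
proof -
  have "(h has_derivative (\<lambda>k. k \<bullet> gradient h x)) (at x)"
    using differentiable_imp_GDERIV_gradient[OF assms(1)] by (simp add: gderiv_def)
  then have "(\<lambda>k. k \<bullet> gradient h x) = (\<lambda>k. 0)"
    using assms(2,3) by (intro differential_zero_maxmin[of x "ball x e" h]) auto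
  then show ?thesis
    by (metis inner_eq_zero_iff)
qed

text \<open>
  The reflected point \<open>- s *\<^sub>R x\<close> is still near \<open>0\<close> for small \<open>s\<close>, and \<open>0\<close> is a convex combination
  of it and \<open>x\<close>; so a negative value at \<open>x\<close> would force \<open>h 0 < 0\<close>.
\<close>
lemma convex_local_max_0_imp_min:
  fixes h :: "'a::real_normed_vector \<Rightarrow> real"
  assumes "convex_on UNIV h" "0 \<in> interior C" "\<And>y. y \<in> C \<Longrightarrow> h y \<le> h 0"
  shows "h 0 \<le> h x"
proof -
  obtain t where t: "t > 0" "(- x) /\<^sub>R t \<in> C"
    using interior_absorbing[OF assms(2)] .
  define y where "y = (- x) /\<^sub>R t"
  \<comment> \<open>Solves \<open>1 - u = u / t\<close>, the weights at which \<open>x\<close> and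
    \<open>y\<close> cancel.\<close>
  define u where "u = t / (1 + t)"
  have u: "0 < u" "u < 1"
    using t(1) by (auto simp: u_def)
  have u_t: "1 - u = u / t"
    using t(1) by (simp add: u_def diff_divide_eq_iff)
  have "(1 - u) *\<^sub>R x + u *\<^sub>R y = 0"
    unfolding u_t y_def by (simp add: divide_inverse)
  then have "h 0 \<le> (1 - u) * h x + u * h y"
    using convex_onD[OF assms(1), of u x y] u by simp
  also have "\<dots> \<le> (1 - u) * h x + u * h 0"
    using assms(3) t u by (simp add: y_def)
  finally have "(1 - u) * h 0 \<le> (1 - u) * h x"
    by (simp add: algebra_simps)
  with u show ?thesis
    by simp
qed

theorem theorem9:
  fixes J :: "'j set"
    and g :: "'j \<Rightarrow> real ^ 'n \<Rightarrow> real"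
    and C :: "(real ^ 'n) set"
    and c :: "real ^ 'n"
    and I :: "'n set"
    and f :: "real ^ 'n \<Rightarrow> real"
    and xbar xhat v :: "real ^ 'n"
  assumes "finite J"
    and "\<And>j. j \<in> J \<Longrightarrow> convex_on UNIV (g j)"
    and "\<And>j x. j \<in> J \<Longrightarrow> g j differentiable (at x)"
    and C_def: "C = {x. \<forall>j\<in>J. g j x \<le> 0}"
    and "0 \<in> interior C"
    and "\<And>j x. j \<in> J \<Longrightarrow> x \<in> frontier C \<Longrightarrow> gradient (g j) x \<noteq> 0"
    and f_def: "f = (\<lambda>x. MAX j\<in>J. g j x)"
    and "xbar \<notin> C"
    and xhat_def: "xhat = xbar /\<^sub>R gauge_function C xbar"
    and "v \<in> subdifferential f xhat"
  shows "\<exists>w \<in> subdifferential (gauge_function C) xbar. \<exists>r>0. \<forall>x.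
           gauge_function C xbar + w \<bullet> (x - xbar) - 1 = r * (f xhat + v \<bullet> (x - xhat))"
proof -
  have cvx: "convex_on UNIV (g j)" and diff: "g j differentiable (at x)" if "j \<in> J" for j x
    using assms(2,3) that by auto
  have cont: "continuous_on UNIV (g j)" if "j \<in> J" for j
    using diff[OF that] by (meson continuous_at_imp_continuous_on differentiable_imp_continuous_within)
  have C_Inter: "C = (\<Inter>j\<in>J. {x. g j x \<le> 0})"
    unfolding C_def by auto
  have "closed C"
    unfolding C_Inter by (intro closed_INT ballI closed_Collect_le cont) auto
  have "convex {x. g j x \<le> 0}" if "j \<in> J" for j
    by (rule convex_on_sublevel[OF cvx[OF that]])
  then have "convex C"
    unfolding C_Inter by (intro convex_INT)
  have "J \<noteq> {}"
    using \<open>xbar \<notin> C\<close> by (auto simp: C_def)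
  have f_ge: "g j x \<le> f x" if "j \<in> J" for j x
    unfolding f_def using \<open>finite J\<close> that by (intro Max_ge) auto
  have f_attained: "\<exists>j\<in>J. f x = g j x" for x
    using Max_in[of "(\<lambda>j. g j x) ` J"] \<open>finite J\<close> \<open>J \<noteq> {}\<close> unfolding f_def by blast
  have f_nonpos: "f x \<le> 0" if "x \<in> C" for x
    using f_attained[of x] that by (auto simp: C_def)

  define p where "p = gauge_function C xbar"
  have "p > 0"
    using gauge_function_ge_1[OF \<open>0 \<in> interior C\<close> \<open>convex C\<close> \<open>xbar \<notin> C\<close>] by (simp add: p_def)
  have xhat_frontier: "xhat \<in> frontier C"
    using scaled_gauge_in_frontier[OF \<open>0 \<in> interior C\<close>] \<open>p > 0\<close> by (simp add: xhat_def p_def)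
  then have "xhat \<in> C"
    using \<open>closed C\<close> frontier_subset_closed by blast
  have xbar: "xbar = p *\<^sub>R xhat"
    using \<open>p > 0\<close> by (simp add: xhat_def p_def[symmetric])

  \<comment> \<open>Otherwise the strict sublevel sets of the finitely many \<open>g j\<close> would
    intersect in an open neighbourhood of \<open>xhat\<close> inside \<open>C\<close>.\<close>
  have "\<not> f xhat < 0"
  proof
    assume "f xhat < 0"
    let ?U = "\<Inter>j\<in>J. {x. g j x < 0}"
    have "open ?U"
      using \<open>finite J\<close> by (intro open_INT ballI open_Collect_less cont) auto
    moreover have "xhat \<in> ?U"
      using f_ge[of _ xhat] \<open>f xhat < 0\<close> by force
    moreover have "?U \<subseteq> C"
      by (auto simp: C_def intro: less_imp_le)
    ultimately show False
      using xhat_frontier by (auto simp: frontier_def interior_def)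
  qed
  with f_nonpos[OF \<open>xhat \<in> C\<close>] have "f xhat = 0"
    by simp
  have v: "v \<bullet> (x - xhat) \<le> f x" for x
    using assms(10) \<open>f xhat = 0\<close> by (simp add: subdifferential_def)
  have v_C: "v \<bullet> y \<le> v \<bullet> xhat" if "y \<in> C" for y
    using v[of y] f_nonpos[OF that] by (simp add: inner_diff_right)

  have "v \<noteq> 0"
  proof
    assume "v = 0"
    have "0 \<in> C"
      using \<open>0 \<in> interior C\<close> interior_subset by blast
    then have "f 0 = 0"
      using v[of 0] f_nonpos[of 0] \<open>v = 0\<close> by simp
    then obtain j where j: "j \<in> J" "g j 0 = 0"
      using f_attained[of 0] by auto
    have "g j 0 \<le> g j x" for x
      using j by (intro convex_local_max_0_imp_min[OF cvx \<open>0 \<in> interior C\<close>]) (auto simp: C_def)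
    then have "g j xhat \<le> g j x" for x
      using \<open>xhat \<in> C\<close> j by (force simp: C_def intro: order_trans)
    then have "gradient (g j) xhat = 0"
      using diff[OF j(1)] by (intro gradient_eq_0_at_local_extremum[of _ _ 1]) auto
    with assms(6)[OF j(1) xhat_frontier] show False
      by simp
  qed
  \<comment> \<open>A point of \<open>C\<close> in direction \<open>v\<close> has positive inner
    product with \<open>v\<close>, and \<open>v_C\<close> passes this on to
    \<open>xhat\<close>.\<close>
  obtain t where t: "t > 0" "v /\<^sub>R t \<in> C"
    using interior_absorbing[OF \<open>0 \<in> interior C\<close>] .
  define s where "s = v \<bullet> xhat"
  have "0 < v \<bullet> (v /\<^sub>R t)"
    using t \<open>v \<noteq> 0\<close> by simp
  also have "\<dots> \<le> s"
    unfolding s_def by (rule v_C[OF t(2)])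
  finally have "s > 0" .

  define w where "w = v /\<^sub>R s"
  have w_xbar: "w \<bullet> xbar = p"
    using \<open>s > 0\<close> by (simp add: w_def xbar s_def[symmetric])
  have "w \<bullet> y \<le> 1" if "y \<in> C" for y
    using v_C[OF that] \<open>s > 0\<close> by (simp add: w_def s_def[symmetric] field_simps)
  then have "w \<bullet> x \<le> gauge_function C x" for x
    by (rule inner_le_gauge_function[OF \<open>0 \<in> interior C\<close>])
  then have "w \<in> subdifferential (gauge_function C) xbar"
    by (simp add: subdifferential_def inner_diff_right w_xbar p_def[symmetric])
  \<comment> \<open>Since \<open>w \<bullet> xbar = p\<close> and \<open>f xhat = 0\<close>, both
    sides reduce to \<open>w \<bullet> x - 1\<close>.\<close>
  moreover have "p + w \<bullet> (x - xbar) - 1 = inverse s * (f xhat + v \<bullet> (x - xhat))" for x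
    using \<open>s > 0\<close> \<open>f xhat = 0\<close>
    by (simp add: inner_diff_right w_xbar s_def[symmetric]) (simp add: w_def field_simps)
  ultimately show ?thesis
    using \<open>s > 0\<close> unfolding p_def by (metis inverse_positive_iff_positive)
qed

end
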